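(* Define $\bar\alpha_1=1$ and $\bar\alpha_{k+1}=\dfrac{2}{1+\sqrt{1+4/\bar\alpha_k^{2}}}$ for $k\ge1$. Then for every $N\ge 1$, $$\frac{2}{(1+a\,k^{-b})k+1}<\bar\alpha_k\le\frac{2}{k+1},\qquad k=1,\dots,N,$$ for any $a>0$ and $0<b<1$ such that $$a(1-b)\,2^{2-b}-ab(1-b)\,2^{-b}-1\ge0.$$ *)

theory Defs
  imports Complex_Main
begin

text \<open>The sequence is indexed from 1; the value at 0 is a dummy.\<close>

fun alpha_bar :: "nat \<Rightarrow> real" where
  "alpha_bar 0 = 0"
| "alpha_bar (Suc 0) = 1"
| "alpha_bar (Suc (Suc k)) = 2 / (1 + sqrt (1 + 4 / (alpha_bar (Suc k))\<^sup>2))"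

lemma alpha_bar_1: "alpha_bar 1 = 1"
  by simp

lemma alpha_bar_rec:
  assumes "k \<ge> 1"
  shows "alpha_bar (k + 1) = 2 / (1 + sqrt (1 + 4 / (alpha_bar k)\<^sup>2))"
  using assms by (cases k) simp_all

end

theory Submission
  imports Defs
begin

text \<open>
  The reciprocals \<open>u\<^sub>k = 2 / \<alpha>\<^sub>k\<close> satisfy \<open>u\<^sub>1 = 2\<close> and
  \<open>u\<^sub>k\<^sub>+\<^sub>1 = 1 + sqrt (1 + u\<^sub>k\<^sup>2)\<close>, so that
  \<open>1 + u\<^sub>k \<le> u\<^sub>k\<^sub>+\<^sub>1 \<le> 1 + u\<^sub>k + 1 / (2 u\<^sub>k)\<close>. The left inequality gives
  \<open>k + 1 \<le> u\<^sub>k\<close>, hence the excess \<open>u\<^sub>k - (k + 1)\<close> grows by at most \<open>1 / (2 (k + 1))\<close>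
  per step. By concavity \<open>a k\<^sup>1\<^sup>-\<^sup>b\<close> grows by at least \<open>a (1 - b) (k + 1)\<^sup>-\<^sup>b\<close>, which is
  larger as soon as \<open>2 a (1 - b) (k + 1)\<^sup>1\<^sup>-\<^sup>b \<ge> 1\<close>; for \<open>k \<ge> 1\<close> this follows from the
  hypothesis on \<open>a\<close> and \<open>b\<close>, whose middle term is not positive.
\<close>

text \<open>The mean value theorem gives a slope at some z < y, and slopes decrease because c - 1
  \<le> 0.\<close>

lemma powr_diff_ge_tangent:
  fixes x y c :: real
  assumes "0 < x" "x \<le> y" "0 \<le> c" "c \<le> 1"
  shows "c * y powr (c - 1) * (y - x) \<le> y powr c - x powr c"
proof (cases "x = y")
  case False
  with assms have "x < y" by simp
  moreover have "((\<lambda>t. t powr c) has_real_derivative c * t powr (c - 1)) (at t)"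
    if "x \<le> t" for t
    using that assms by (intro has_real_derivative_powr) auto
  ultimately obtain z where z: "x < z" "z < y"
    and eq: "y powr c - x powr c = (y - x) * (c * z powr (c - 1))"
    using MVT2[of x y "\<lambda>t. t powr c" "\<lambda>t. c * t powr (c - 1)"] by blast
  have "y powr (c - 1) \<le> z powr (c - 1)"
    using z assms by (intro powr_mono2') auto
  then have "(y - x) * (c * y powr (c - 1)) \<le> (y - x) * (c * z powr (c - 1))"
    using assms by (intro mult_left_mono) auto
  then show ?thesis by (simp add: eq mult_ac)
qed simp

text \<open>The cross term in the square of the right side is 1, so the surplus is (1 / (2
  u))^2.\<close>

lemma sqrt_one_plus_square_le:
  fixes u :: real
  assumes "0 < u"
  shows "sqrt (1 + u\<^sup>2) \<le> u + 1 / (2 * u)"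
proof (rule real_le_lsqrt)
  have "(u + 1 / (2 * u))\<^sup>2 = u\<^sup>2 + 1 + (1 / (2 * u))\<^sup>2"
    using assms by (simp add: power2_sum)
  then show "1 + u\<^sup>2 \<le> (u + 1 / (2 * u))\<^sup>2" by simp
qed (use assms in auto)

lemma alpha_bar_pos: "1 \<le> k \<Longrightarrow> 0 < alpha_bar k"
proof (induction k rule: nat_induct_at_least)
  case (Suc k)
  have "0 < 1 + sqrt (1 + 4 / (alpha_bar k)\<^sup>2)"
    by (intro add_pos_nonneg) auto
  with Suc show ?case using alpha_bar_rec[of k] by simp
qed simp

lemma two_div_alpha_bar_rec:
  assumes "1 \<le> k"
  shows "2 / alpha_bar (Suc k) = 1 + sqrt (1 + (2 / alpha_bar k)\<^sup>2)"
  using alpha_bar_rec[OF assms] by (simp add: power_divide)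

lemma two_div_alpha_bar_ge: "1 \<le> k \<Longrightarrow> real k + 1 \<le> 2 / alpha_bar k"
proof (induction k rule: nat_induct_at_least)
  case (Suc k)
  have "2 / alpha_bar k \<le> sqrt (1 + (2 / alpha_bar k)\<^sup>2)"
    by (rule real_le_rsqrt) simp
  then show ?case using Suc two_div_alpha_bar_rec[of k] by simp
qed simp

lemma two_div_alpha_bar_less:
  fixes a c :: real
  assumes "0 < a" "0 < c" "c \<le> 1" and ac: "1 \<le> 2 * a * c * 2 powr c"
    and "1 \<le> k"
  shows "2 / alpha_bar k < real k + 1 + a * real k powr c"
  using \<open>1 \<le> k\<close>
proof (induction k rule: nat_induct_at_least)
  case base
  \<comment> \<open>Strictness starts here, as 2 < 2 + a; the induction step compares increments
    only weakly.\<close>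
  then show ?case using assms by simp
next
  case (Suc k)
  define u where "u = 2 / alpha_bar k"
  have u: "real k + 1 \<le> u"
    unfolding u_def using Suc two_div_alpha_bar_ge by blast
  have "1 / (2 * u) \<le> 1 / (2 * (real k + 1))"
    using u by (intro divide_left_mono) auto
  moreover have "sqrt (1 + u\<^sup>2) \<le> u + 1 / (2 * u)"
    using u by (intro sqrt_one_plus_square_le) linarith
  moreover have "2 / alpha_bar (Suc k) = 1 + sqrt (1 + u\<^sup>2)"
    unfolding u_def using Suc.hyps by (rule two_div_alpha_bar_rec)
  ultimately have step: "2 / alpha_bar (Suc k) \<le> 1 + u + 1 / (2 * (real k + 1))"
    by linarith
  \<comment> \<open>The worst case is k = 1, where k + 1 = 2; hence the base 2 in
    \<open>ac\<close>.\<close>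
  have "2 powr c \<le> (real k + 1) powr c"
    using Suc assms by (intro powr_mono2) auto
  then have "2 * a * c * 2 powr c \<le> 2 * a * c * (real k + 1) powr c"
    using assms by (intro mult_left_mono) auto
  with ac have "1 \<le> 2 * a * c * (real k + 1) powr c" by linarith
  then have "1 / (2 * (real k + 1)) \<le> (2 * a * c * (real k + 1) powr c) / (2 * (real k + 1))"
    by (intro divide_right_mono) auto
  also have "\<dots> = a * (c * (real k + 1) powr (c - 1))"
    by (simp add: powr_diff divide_simps)
  also have "\<dots> \<le> a * ((real k + 1) powr c - real k powr c)"
    using powr_diff_ge_tangent[of "real k" "real k + 1" c] assms Suc
    by (intro mult_left_mono) auto
  finally show ?case
    using step Suc.IH by (simp add: u_def algebra_simps)
qed

theorem theorem3:
  fixes N :: nat and a b :: real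
  assumes "N \<ge> 1"
    and "a > 0" and "0 < b" and "b < 1"
    and "a * (1 - b) * 2 powr (2 - b) - a * b * (1 - b) * 2 powr (- b) - 1 \<ge> 0"
  shows "\<forall>k\<in>{1..N}.
           2 / ((1 + a * real k powr (- b)) * real k + 1) < alpha_bar k \<and>
           alpha_bar k \<le> 2 / (real k + 1)"
proof
  fix k assume "k \<in> {1..N}"
  then have k: "1 \<le> k" by simp
  note pos = alpha_bar_pos[OF k]
  have "0 \<le> a * b * (1 - b) * 2 powr (- b)" using assms by simp
  with assms(5) have "1 \<le> a * (1 - b) * 2 powr (2 - b)" by linarith
  \<comment> \<open>Splitting off a factor 2 gives the condition \<open>ac\<close> for c = 1 -
    b.\<close>
  also have "2 powr (2 - b) = 2 * 2 powr (1 - b)"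
    using powr_add[of 2 1 "1 - b"] by simp
  finally have "1 \<le> 2 * a * (1 - b) * 2 powr (1 - b)"
    by (simp only: mult_ac)
  then have "2 / alpha_bar k < real k + 1 + a * real k powr (1 - b)"
    using two_div_alpha_bar_less[of a "1 - b" k] assms k by simp
  also have "\<dots> = (1 + a * real k powr (- b)) * real k + 1"
    using k by (simp add: powr_diff powr_minus field_simps)
  finally have "2 / alpha_bar k < (1 + a * real k powr (- b)) * real k + 1" .
  moreover have "0 < (1 + a * real k powr (- b)) * real k + 1"
    using assms by (intro add_nonneg_pos mult_nonneg_nonneg) auto
  ultimately have "2 / ((1 + a * real k powr (- b)) * real k + 1) < alpha_bar k"
    using pos by (simp add: pos_divide_less_eq mult.commute)
  moreover have "alpha_bar k \<le> 2 / (real k + 1)"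
    using two_div_alpha_bar_ge[OF k] pos by (simp add: field_simps)
  ultimately show "2 / ((1 + a * real k powr (- b)) * real k + 1) < alpha_bar k \<and>
           alpha_bar k \<le> 2 / (real k + 1)" ..
qed

end
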